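(* Let $p:\mathbb{R}^n\to\mathbb{R}$ be a cubic polynomial with a second-order point, and let $(\gamma^*,\sigma^*,S^* )$ be an optimal solution of the semidefinite program $$\begin{aligned} \sup_{\gamma\in\mathbb{R},\,\sigma(x),\,S(x)}\quad & \gamma\\ \text{subject to}\quad & p(x)-\gamma=\sigma(x)+\mathrm{Tr}(S(x)\nabla^2 p(x)),\\ & \sigma(x)\ \text{is a degree-2 sos polynomial},\\ & S(x)\ \text{is an } n\times n \text{ sos-matrix with degree-2 entries}. \end{aligned}$$ Then the set $$\Gamma=\{x\in\mathbb{R}^n \mid \nabla^2 p(x)\succeq 0,\ \sigma^*(x)=0,\ \mathrm{Tr}(S^*(x)\nabla^2 p(x))=0\}$$ is a spectrahedron, and $\Gamma=SO_p$, where $SO_p$ is the set of second-order points of $p$.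
   Context: A cubic (resp. degree-2) polynomial is a real polynomial all of whose monomials have degree at most 3 (resp. at most 2). A second-order point of $p$ is a point $x$ with $\nabla p(x)=0$ and $\nabla^2 p(x)\succeq 0$ (positive semidefinite). $\mathrm{Tr}$ is the trace. A polynomial is sos (a sum of squares) if it equals $\sum_{i=1}^r q_i^2$ for some polynomials $q_i$. A symmetric $m\times m$ matrix $M(x)$ with polynomial entries is an sos-matrix if $M(x)=R(x)^TR(x)$ for some $r\times m$ polynomial matrix $R(x)$. In the program, $x$ is not a decision variable: the decision variables are $\gamma$, the coefficients of $\sigma$, and the coefficients of the entries of $S$, and the first constraint is an identity of polynomials in $x\in\mathbb{R}^n$. A spectrahedron in $\mathbb{R}^n$ is a set of the form $\{x\in\mathbb{R}^n \mid A_0+\sum_{i=1}^n x_iA_i\succeq 0\}$ with $A_0,\ldots,A_n$ real symmetric matrices of some common size. *)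

theory Defs
  imports "HOL-Analysis.Analysis"
begin

text \<open>
  Polynomials in \<open>n\<close> real variables are represented by the functions they induce on
  \<open>real ^ 'n\<close>; as \<open>\<real>\<close> is infinite, an identity of polynomials is the same as an identity of
  functions. Polynomials of unrestricted degree are \<^const>\<open>real_polynomial_function\<close>.
\<close>

text \<open>All monomials have degree at most \<open>d\<close>; \<open>\<alpha>\<close> ranges over the exponent vectors.\<close>

definition poly_deg_le :: "nat \<Rightarrow> (real ^ 'n \<Rightarrow> real) \<Rightarrow> bool" where
  "poly_deg_le d f \<longleftrightarrow>
     (\<exists>c :: ('n \<Rightarrow> nat) \<Rightarrow> real.
        \<forall>x. f x = (\<Sum>\<alpha> | (\<Sum>i\<in>UNIV. \<alpha> i) \<le> d. c \<alpha> * (\<Prod>i\<in>UNIV. x $ i ^ \<alpha> i)))"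

text \<open>The index set of the sum is finite, so the sum is not the default value \<open>0\<close>.\<close>

lemma finite_exponents: "finite {\<alpha> :: 'n::finite \<Rightarrow> nat. (\<Sum>i\<in>UNIV. \<alpha> i) \<le> d}"
proof (rule finite_subset)
  show "{\<alpha> :: 'n \<Rightarrow> nat. (\<Sum>i\<in>UNIV. \<alpha> i) \<le> d} \<subseteq> Pi\<^sub>E UNIV (\<lambda>_. {..d})"
  proof (clarsimp simp: PiE_UNIV_domain)
    fix \<alpha> :: "'n \<Rightarrow> nat" and i
    assume "(\<Sum>i\<in>UNIV. \<alpha> i) \<le> d"
    moreover have "\<alpha> i \<le> (\<Sum>i\<in>UNIV. \<alpha> i)"
      by (rule member_le_sum) simp_all
    ultimately show "\<alpha> i \<le> d" by linarith
  qed
  show "finite (Pi\<^sub>E (UNIV :: 'n set) (\<lambda>_. {..d}))"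
    by (rule finite_PiE) auto
qed

lemma poly_deg_le_imp_polynomial:
  assumes "poly_deg_le d f"
  shows "real_polynomial_function f"
proof -
  obtain c where "\<And>x. f x = (\<Sum>\<alpha> | (\<Sum>i\<in>UNIV. \<alpha> i) \<le> d. c \<alpha> * (\<Prod>i\<in>UNIV. x $ i ^ \<alpha> i))"
    using assms unfolding poly_deg_le_def by blast
  then have f: "f = (\<lambda>x. \<Sum>\<alpha> | (\<Sum>i\<in>UNIV. \<alpha> i) \<le> d. c \<alpha> * (\<Prod>i\<in>UNIV. x $ i ^ \<alpha> i))"
    by blast
  have "real_polynomial_function (\<lambda>x :: real ^ 'n. x $ i)" for i
    by (intro real_polynomial_function.intros(1) bounded_linear_vec_nth)
  then show ?thesis
    unfolding f
    by (intro real_polynomial_function_sum real_polynomial_function.intros(2,4)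
        real_polynomial_function_prod
        real_polynomial_function_power finite_exponents finite)
qed

definition partial_deriv :: "'n \<Rightarrow> (real ^ 'n \<Rightarrow> real) \<Rightarrow> real ^ 'n \<Rightarrow> real" where
  "partial_deriv i f x = frechet_derivative f (at x) (axis i 1)"

definition gradient :: "(real ^ 'n \<Rightarrow> real) \<Rightarrow> real ^ 'n \<Rightarrow> real ^ 'n" where
  "gradient f x = (\<chi> i. partial_deriv i f x)"

definition hessian :: "(real ^ 'n \<Rightarrow> real) \<Rightarrow> real ^ 'n \<Rightarrow> real ^ 'n ^ 'n" where
  "hessian f x = (\<chi> i j. partial_deriv i (partial_deriv j f) x)"

text \<open>
  Positive semidefiniteness of a symmetric matrix with rows and columns indexed by \<open>I\<close>. The index
  set is explicit because the size of the matrices defining a spectrahedron is existentially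
  quantified and hence cannot be a type.
\<close>

definition psd_on :: "'i set \<Rightarrow> ('i \<Rightarrow> 'i \<Rightarrow> real) \<Rightarrow> bool" where
  "psd_on I M \<longleftrightarrow>
     (\<forall>i\<in>I. \<forall>j\<in>I. M i j = M j i) \<and>
     (\<forall>v. 0 \<le> (\<Sum>i\<in>I. \<Sum>j\<in>I. v i * M i j * v j))"

definition psd :: "real ^ 'm ^ 'm \<Rightarrow> bool" where
  "psd M \<longleftrightarrow> psd_on UNIV (\<lambda>i j. M $ i $ j)"

definition second_order_points :: "(real ^ 'n \<Rightarrow> real) \<Rightarrow> (real ^ 'n) set" where
  "second_order_points p = {x. gradient p x = 0 \<and> psd (hessian p x)}"

definition sos :: "(real ^ 'n \<Rightarrow> real) \<Rightarrow> bool" where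
  "sos f \<longleftrightarrow>
     (\<exists>(r :: nat) q. (\<forall>k<r. real_polynomial_function (q k)) \<and> (\<forall>x. f x = (\<Sum>k<r. (q k x)\<^sup>2)))"

text \<open>\<open>R k i\<close> is the entry in row \<open>k\<close>, column \<open>i\<close> of the polynomial \<open>r \<times> m\<close> matrix \<open>R(x)\<close>; the
  last equation is \<open>M(x) = R(x)\<^sup>T R(x)\<close>.\<close>

definition sos_matrix :: "(real ^ 'n \<Rightarrow> real ^ 'm ^ 'm) \<Rightarrow> bool" where
  "sos_matrix M \<longleftrightarrow>
     (\<exists>(r :: nat) (R :: nat \<Rightarrow> 'm \<Rightarrow> real ^ 'n \<Rightarrow> real).
        (\<forall>k<r. \<forall>i. real_polynomial_function (R k i)) \<and>
        (\<forall>x i j. M x $ i $ j = (\<Sum>k<r. R k i x * R k j x)))"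

definition sdp_feasible ::
  "(real ^ 'n \<Rightarrow> real) \<Rightarrow> real \<Rightarrow> (real ^ 'n \<Rightarrow> real) \<Rightarrow> (real ^ 'n \<Rightarrow> real ^ 'n ^ 'n) \<Rightarrow> bool"
where
  "sdp_feasible p \<gamma> \<sigma> S \<longleftrightarrow>
     (\<forall>x. p x - \<gamma> = \<sigma> x + trace (S x ** hessian p x)) \<and>
     poly_deg_le 2 \<sigma> \<and> sos \<sigma> \<and>
     sos_matrix S \<and> (\<forall>i j. poly_deg_le 2 (\<lambda>x. S x $ i $ j))"

definition sdp_optimal ::
  "(real ^ 'n \<Rightarrow> real) \<Rightarrow> real \<Rightarrow> (real ^ 'n \<Rightarrow> real) \<Rightarrow> (real ^ 'n \<Rightarrow> real ^ 'n ^ 'n) \<Rightarrow> bool"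
where
  "sdp_optimal p \<gamma> \<sigma> S \<longleftrightarrow>
     sdp_feasible p \<gamma> \<sigma> S \<and> (\<forall>\<gamma>' \<sigma>' S'. sdp_feasible p \<gamma>' \<sigma>' S' \<longrightarrow> \<gamma>' \<le> \<gamma>)"

definition spectrahedron :: "(real ^ 'n) set \<Rightarrow> bool" where
  "spectrahedron X \<longleftrightarrow>
     (\<exists>(m :: nat) (A0 :: nat \<Rightarrow> nat \<Rightarrow> real) (A :: 'n \<Rightarrow> nat \<Rightarrow> nat \<Rightarrow> real).
        (\<forall>a<m. \<forall>b<m. A0 a b = A0 b a) \<and>
        (\<forall>i. \<forall>a<m. \<forall>b<m. A i a b = A i b a) \<and>
        X = {x. psd_on {..<m} (\<lambda>a b. A0 a b + (\<Sum>i\<in>UNIV. x $ i * A i a b))})"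

end

theory Submission
  imports Defs
begin

text \<open>
  At a second-order point \<open>a\<close> a cubic is \<open>p (a + y) = p a + (1/2) y \<bullet> H y + (1/6) y \<bullet> C(y) y\<close> with
  Hessian \<open>H + C(y)\<close>, \<open>C\<close> linear, so \<open>\<sigma> = (1/3) y \<bullet> H y\<close> and \<open>S = (1/6) y y\<^sup>T\<close> are feasible with
  \<open>\<gamma> = p a\<close>. No larger \<open>\<gamma>\<close> is feasible, as both terms on the right of the constraint are nonnegative
  at \<open>a\<close>. Hence \<open>\<Gamma>\<close> consists of the points with positive semidefinite Hessian at which \<open>p\<close> takes
  the value \<open>p a\<close>. At such a point \<open>a + y\<close>, the nonnegativity of \<open>y \<bullet> H y\<close> and
  \<open>y \<bullet> (H + C(y)) y\<close> forces \<open>H y = 0\<close> and \<open>C(y) y = 0\<close>, so the gradient \<open>H y + (1/2) C(y) y\<close>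
  vanishes.

  The set of second-order points is closed under midpoints; polarizing \<open>C(y) y = 0\<close>, the gradient
  vanishes on its whole affine hull. So it is the intersection of an affine subspace with the
  spectrahedron on which the Hessian is positive semidefinite.
\<close>

section \<open>Polynomials of bounded degree\<close>

definition monom_fun :: "('n \<Rightarrow> nat) \<Rightarrow> real ^ 'n \<Rightarrow> real" where
  "monom_fun \<alpha> x = (\<Prod>i\<in>UNIV. x $ i ^ \<alpha> i)"

lemma monom_fun_mult: "monom_fun \<alpha> x * monom_fun \<beta> x = monom_fun (\<lambda>i. \<alpha> i + \<beta> i) x"
  by (simp add: monom_fun_def power_add prod.distrib)

lemma monom_fun_0 [simp]: "monom_fun (\<lambda>i. 0) x = 1"
  by (simp add: monom_fun_def)

lemma monom_fun_single: "monom_fun (\<lambda>j. if j = i then 1 else 0) x = x $ i"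
proof -
  have "monom_fun (\<lambda>j. if j = i then 1 else 0) x = (\<Prod>j\<in>UNIV. if j = i then x $ j else 1)"
    unfolding monom_fun_def by (intro prod.cong) auto
  then show ?thesis by simp
qed

lemma poly_deg_le_iff:
  "poly_deg_le d f \<longleftrightarrow> (\<exists>c. \<forall>x. f x = (\<Sum>\<alpha> | sum \<alpha> UNIV \<le> d. c \<alpha> * monom_fun \<alpha> x))"
  by (simp add: poly_deg_le_def monom_fun_def)

lemma poly_deg_le_monom: "poly_deg_le d (monom_fun \<alpha>)" if "sum \<alpha> UNIV \<le> d"
  unfolding poly_deg_le_iff
proof (intro exI allI)
  fix x
  have "(\<Sum>\<beta> | sum \<beta> UNIV \<le> d. (if \<beta> = \<alpha> then 1 else 0) * monom_fun \<beta> x)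
      = (\<Sum>\<beta> | sum \<beta> UNIV \<le> d. if \<beta> = \<alpha> then monom_fun \<beta> x else 0)"
    by (intro sum.cong) auto
  then show "monom_fun \<alpha> x = (\<Sum>\<beta> | sum \<beta> UNIV \<le> d. (if \<beta> = \<alpha> then 1 else 0) * monom_fun \<beta> x)"
    using that by (simp add: finite_exponents sum.delta)
qed

lemma poly_deg_le_add:
  assumes "poly_deg_le d f" "poly_deg_le d g"
  shows "poly_deg_le d (\<lambda>x. f x + g x)"
proof -
  obtain a b where "\<And>x. f x = (\<Sum>\<alpha> | sum \<alpha> UNIV \<le> d. a \<alpha> * monom_fun \<alpha> x)"
    "\<And>x. g x = (\<Sum>\<alpha> | sum \<alpha> UNIV \<le> d. b \<alpha> * monom_fun \<alpha> x)"
    using assms unfolding poly_deg_le_iff by blast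
  then show ?thesis
    unfolding poly_deg_le_iff
    by (intro exI[of _ "\<lambda>\<alpha>. a \<alpha> + b \<alpha>"]) (simp add: sum.distrib algebra_simps)
qed

lemma poly_deg_le_cmult:
  assumes "poly_deg_le d f"
  shows "poly_deg_le d (\<lambda>x. r * f x)"
proof -
  obtain a where "\<And>x. f x = (\<Sum>\<alpha> | sum \<alpha> UNIV \<le> d. a \<alpha> * monom_fun \<alpha> x)"
    using assms unfolding poly_deg_le_iff by blast
  then show ?thesis
    unfolding poly_deg_le_iff
    by (intro exI[of _ "\<lambda>\<alpha>. r * a \<alpha>"]) (simp add: sum_distrib_left algebra_simps)
qed

lemma poly_deg_le_const: "poly_deg_le d (\<lambda>x. r)"
  using poly_deg_le_cmult[OF poly_deg_le_monom[of "\<lambda>i. 0" d], of r] by simp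

lemma poly_deg_le_sum:
  assumes "\<And>k. k \<in> A \<Longrightarrow> poly_deg_le d (f k)"
  shows "poly_deg_le d (\<lambda>x. \<Sum>k\<in>A. f k x)"
  using assms
  by (induction A rule: infinite_finite_induct) (auto intro: poly_deg_le_const poly_deg_le_add)

lemma poly_deg_le_mult:
  assumes "poly_deg_le d f" "poly_deg_le e g"
  shows "poly_deg_le (d + e) (\<lambda>x. f x * g x)"
proof -
  obtain a b where f: "\<And>x. f x = (\<Sum>\<alpha> | sum \<alpha> UNIV \<le> d. a \<alpha> * monom_fun \<alpha> x)"
    and g: "\<And>x. g x = (\<Sum>\<alpha> | sum \<alpha> UNIV \<le> e. b \<alpha> * monom_fun \<alpha> x)"
    using assms unfolding poly_deg_le_iff by blast
  have "(\<lambda>x. f x * g x) = (\<lambda>x. \<Sum>\<alpha> | sum \<alpha> UNIV \<le> d. \<Sum>\<beta> | sum \<beta> UNIV \<le> e.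
      (a \<alpha> * b \<beta>) * monom_fun (\<lambda>i. \<alpha> i + \<beta> i) x)"
    by (simp add: f g sum_product monom_fun_mult[symmetric] algebra_simps)
  moreover have "poly_deg_le (d + e) \<dots>"
    by (intro poly_deg_le_sum poly_deg_le_cmult poly_deg_le_monom) (simp add: sum.distrib add_mono)
  ultimately show ?thesis by simp
qed

lemma poly_deg_le_square: "poly_deg_le 2 (\<lambda>x. (f x)\<^sup>2)" if "poly_deg_le 1 f"
  using poly_deg_le_mult[OF that that] by (simp add: power2_eq_square numeral_2_eq_2)

lemma poly_deg_le_component: "poly_deg_le 1 (\<lambda>x. x $ i)"
  using poly_deg_le_monom[of "\<lambda>j. if j = i then 1 else 0" 1]
  by (simp add: monom_fun_single[abs_def])

lemma poly_deg_le_inner: "poly_deg_le 1 (\<lambda>x :: real ^ 'n. v \<bullet> (x - a))"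
proof -
  have "(\<lambda>x. v \<bullet> (x - a)) = (\<lambda>x. (\<Sum>i\<in>UNIV. v $ i * x $ i) + - (v \<bullet> a))"
    by (simp add: inner_diff_right) (simp add: inner_vec_def)
  moreover have "poly_deg_le 1 \<dots>"
    by (intro poly_deg_le_add poly_deg_le_sum poly_deg_le_cmult poly_deg_le_component
        poly_deg_le_const)
  ultimately show ?thesis by simp
qed

section \<open>Factoring variables out of a polynomial\<close>

lemma poly_deg_le_0D:
  fixes f :: "real ^ 'n \<Rightarrow> real"
  assumes "poly_deg_le 0 f"
  shows "\<exists>c. \<forall>x. f x = c"
proof -
  have "{\<alpha> :: 'n \<Rightarrow> nat. sum \<alpha> UNIV \<le> 0} = {\<lambda>i. 0}" by auto
  then show ?thesis using assms unfolding poly_deg_le_iff by auto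
qed

text \<open>A nonconstant monomial is divided by one variable that occurs in it, and
  \<open>h\<close> is nonzero at that index only. The sum over all indices gives every monomial the
  same shape, so that linear combinations can be taken termwise.\<close>

lemma monom_fun_SucE:
  assumes "sum \<alpha> UNIV \<le> Suc d"
  obtains c h where "\<And>i. poly_deg_le d (h i)"
    "\<And>x. monom_fun \<alpha> x = c + (\<Sum>i\<in>UNIV. x $ i * h i x)"
proof (cases "\<forall>i. \<alpha> i = 0")
  case True
  then have "\<alpha> = (\<lambda>i. 0)" by auto
  then show ?thesis by (intro that[of "\<lambda>i x. 0" 1]) (auto intro: poly_deg_le_const)
next
  case False
  then obtain j where j: "\<alpha> j > 0" by auto
  \<comment> \<open>The exponent vector after dividing by the variable with index
    \<open>j\<close>.\<close>
  define \<beta> where "\<beta> i = (if i = j then \<alpha> j - 1 else \<alpha> i)" for i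
  have \<alpha>: "\<alpha> = (\<lambda>i. (if i = j then 1 else 0) + \<beta> i)"
    using j by (auto simp: \<beta>_def)
  have "sum \<alpha> UNIV = 1 + sum \<beta> UNIV"
    by (subst \<alpha>) (simp add: sum.distrib)
  then have deg: "sum \<beta> UNIV \<le> d" using assms by simp
  show ?thesis
  proof (intro that[of "\<lambda>i x. if i = j then monom_fun \<beta> x else 0" 0])
    show "poly_deg_le d (\<lambda>x. if i = j then monom_fun \<beta> x else 0)" for i
      using deg by (cases "i = j") (auto intro: poly_deg_le_monom poly_deg_le_const)
    show "monom_fun \<alpha> x = 0 + (\<Sum>i\<in>UNIV. x $ i * (if i = j then monom_fun \<beta> x else 0))" for x
      by (subst \<alpha>, subst monom_fun_mult[symmetric], subst monom_fun_single)
        (simp add: if_distrib[of "(*) _"] sum.delta cong: if_cong)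
  qed
qed

lemma poly_deg_le_SucD:
  fixes f :: "real ^ 'n \<Rightarrow> real"
  assumes "poly_deg_le (Suc d) f"
  shows "\<exists>c h. (\<forall>i. poly_deg_le d (h i)) \<and> (\<forall>x. f x = c + (\<Sum>i\<in>UNIV. x $ i * h i x))"
proof -
  let ?I = "{\<alpha> :: 'n \<Rightarrow> nat. sum \<alpha> UNIV \<le> Suc d}"
  obtain a where f: "\<And>x. f x = (\<Sum>\<alpha>\<in>?I. a \<alpha> * monom_fun \<alpha> x)"
    using assms unfolding poly_deg_le_iff by blast
  have "\<forall>\<alpha>\<in>?I. \<exists>c h. (\<forall>i. poly_deg_le d (h i)) \<and>
      (\<forall>x. monom_fun \<alpha> x = c + (\<Sum>i\<in>UNIV. x $ i * h i x))"
    using monom_fun_SucE by (metis mem_Collect_eq)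
  from bchoice[OF this] obtain c where "\<forall>\<alpha>\<in>?I. \<exists>h. (\<forall>i. poly_deg_le d (h i)) \<and>
      (\<forall>x. monom_fun \<alpha> x = c \<alpha> + (\<Sum>i\<in>UNIV. x $ i * h i x))" ..
  from bchoice[OF this] obtain h where ch: "\<And>\<alpha> i. \<alpha> \<in> ?I \<Longrightarrow> poly_deg_le d (h \<alpha> i)"
    "\<And>\<alpha> x. \<alpha> \<in> ?I \<Longrightarrow> monom_fun \<alpha> x = c \<alpha> + (\<Sum>i\<in>UNIV. x $ i * h \<alpha> i x)"
    by blast
  have "f x = (\<Sum>\<alpha>\<in>?I. a \<alpha> * c \<alpha>) + (\<Sum>i\<in>UNIV. x $ i * (\<Sum>\<alpha>\<in>?I. a \<alpha> * h \<alpha> i x))" for x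
  proof -
    have "f x = (\<Sum>\<alpha>\<in>?I. a \<alpha> * (c \<alpha> + (\<Sum>i\<in>UNIV. x $ i * h \<alpha> i x)))"
      unfolding f by (intro sum.cong refl) (simp only: ch(2))
    also have "\<dots> = (\<Sum>\<alpha>\<in>?I. a \<alpha> * c \<alpha>) + (\<Sum>\<alpha>\<in>?I. \<Sum>i\<in>UNIV. x $ i * (a \<alpha> * h \<alpha> i x))"
      by (simp add: distrib_left sum.distrib sum_distrib_left mult.left_commute)
    also have "(\<Sum>\<alpha>\<in>?I. \<Sum>i\<in>UNIV. x $ i * (a \<alpha> * h \<alpha> i x))
        = (\<Sum>i\<in>UNIV. x $ i * (\<Sum>\<alpha>\<in>?I. a \<alpha> * h \<alpha> i x))"
      by (subst sum.swap) (simp add: sum_distrib_left)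
    finally show ?thesis .
  qed
  moreover have "poly_deg_le d (\<lambda>x. \<Sum>\<alpha>\<in>?I. a \<alpha> * h \<alpha> i x)" for i
    by (intro poly_deg_le_sum poly_deg_le_cmult ch(1))
  ultimately show ?thesis
    by (intro exI[of _ "\<Sum>\<alpha>\<in>?I. a \<alpha> * c \<alpha>"] exI[of _ "\<lambda>i x. \<Sum>\<alpha>\<in>?I. a \<alpha> * h \<alpha> i x"]) blast
qed

lemma choice2: "\<forall>x y. \<exists>z. Q x y z \<Longrightarrow> \<exists>f. \<forall>x y. Q x y (f x y)"
  by metis

text \<open>Variables are factored out three times. The coefficients \<open>b\<close> and
  \<open>d\<close> obtained in this way need not be symmetric; \<open>cubic_expansion_exists\<close>
  symmetrizes them.\<close>

lemma poly_deg_le_3_nested: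
  fixes p :: "real ^ 'n \<Rightarrow> real"
  assumes "poly_deg_le 3 p"
  shows "\<exists>c a b d. \<forall>x. p x = c + (\<Sum>i\<in>UNIV. x $ i * (a i + (\<Sum>j\<in>UNIV. x $ j *
      (b i j + (\<Sum>k\<in>UNIV. x $ k * d i j k)))))"
proof -
  obtain c h where h: "\<And>i. poly_deg_le 2 (h i)" "\<And>x. p x = c + (\<Sum>i\<in>UNIV. x $ i * h i x)"
    using poly_deg_le_SucD[of 2 p] assms by (auto simp: numeral_eq_Suc)
  have "\<forall>i. \<exists>c f. (\<forall>j. poly_deg_le 1 (f j)) \<and> (\<forall>x. h i x = c + (\<Sum>j\<in>UNIV. x $ j * f j x))"
    using poly_deg_le_SucD[of 1 "h _"] h(1) by (simp add: numeral_2_eq_2)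
  from choice[OF this] obtain a where
    "\<forall>i. \<exists>f. (\<forall>j. poly_deg_le 1 (f j)) \<and> (\<forall>x. h i x = a i + (\<Sum>j\<in>UNIV. x $ j * f j x))" ..
  from choice[OF this] obtain h' where h': "\<And>i j. poly_deg_le 1 (h' i j)"
    "\<And>i x. h i x = a i + (\<Sum>j\<in>UNIV. x $ j * h' i j x)" by blast
  have "\<forall>i. \<forall>j. \<exists>c f. (\<forall>k. poly_deg_le 0 (f k)) \<and>
      (\<forall>x. h' i j x = c + (\<Sum>k\<in>UNIV. x $ k * f k x))"
    using poly_deg_le_SucD[of 0 "h' _ _"] h'(1) by simp
  from choice2[OF this] obtain b where "\<forall>i. \<forall>j. \<exists>f. (\<forall>k. poly_deg_le 0 (f k)) \<and>
      (\<forall>x. h' i j x = b i j + (\<Sum>k\<in>UNIV. x $ k * f k x))" ..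
  from choice2[OF this] obtain h'' where h'': "\<And>i j k. poly_deg_le 0 (h'' i j k)"
    "\<And>i j x. h' i j x = b i j + (\<Sum>k\<in>UNIV. x $ k * h'' i j k x)" by blast
  obtain d where "\<And>i j k x. h'' i j k x = d i j k"
    using poly_deg_le_0D[OF h''(1)] by metis
  then show ?thesis
    by (auto simp: h(2) h'(2) h''(2))
qed

section \<open>Positive semidefinite forms\<close>

locale psd_operator =
  fixes A :: "'a :: euclidean_space \<Rightarrow> 'a"
  assumes linear: "linear A"
    and sym: "x \<bullet> A y = y \<bullet> A x"
    and nonneg: "0 \<le> x \<bullet> A x"
begin

text \<open>The form is nonnegative at \<open>x + t y\<close>, which gives a nonnegative polynomial
  in \<open>t\<close> of degree at most 2.\<close>

lemma Cauchy_Schwarz: "(x \<bullet> A y)\<^sup>2 \<le> (x \<bullet> A x) * (y \<bullet> A y)"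
proof -
  have quad: "0 \<le> x \<bullet> A x + 2 * t * (x \<bullet> A y) + t\<^sup>2 * (y \<bullet> A y)" for t
    using nonneg[of "x + t *\<^sub>R y"] sym[of y x]
    by (simp add: linear_add[OF linear] linear_scale[OF linear] inner_add_left inner_add_right
        power2_eq_square algebra_simps)
  show ?thesis
  proof (cases "y \<bullet> A y = 0")
    case True
    have "x \<bullet> A y = 0"
    proof (rule ccontr)
      \<comment> \<open>The polynomial is now affine in \<open>t\<close>, and the chosen
        \<open>t\<close> gives it the value -1.\<close>
      assume "x \<bullet> A y \<noteq> 0"
      then show False
        using quad[of "- (x \<bullet> A x + 1) / (2 * (x \<bullet> A y))"] True by (simp add: field_simps)
    qed
    then show ?thesis using True by simp
  next
    case False
    then have pos: "y \<bullet> A y > 0" using nonneg[of y] by linarith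
    \<comment> \<open>This \<open>t\<close> minimizes the polynomial.\<close>
    have "x \<bullet> A x + 2 * (- (x \<bullet> A y) / (y \<bullet> A y)) * (x \<bullet> A y)
        + (- (x \<bullet> A y) / (y \<bullet> A y))\<^sup>2 * (y \<bullet> A y) = x \<bullet> A x - (x \<bullet> A y)\<^sup>2 / (y \<bullet> A y)"
      using pos by (simp add: field_simps power2_eq_square)
    then have "(x \<bullet> A y)\<^sup>2 / (y \<bullet> A y) \<le> x \<bullet> A x"
      using quad[of "- (x \<bullet> A y) / (y \<bullet> A y)"] by linarith
    then show ?thesis using pos by (simp add: field_simps)
  qed
qed

text \<open>Cauchy-Schwarz with \<open>x = A y\<close> bounds the square of
  \<open>A y \<bullet> A y\<close> by 0.\<close>

lemma null_vector: "A y = 0" if "y \<bullet> A y = 0"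
  using Cauchy_Schwarz[of "A y" y] that by simp

text \<open>Nonnegativity is Cauchy-Schwarz for \<open>x\<close> and \<open>u\<close>. If
  \<open>u \<bullet> A u = 0\<close>, the quotient has the default value 0 and the operator is
  \<open>A\<close> itself.\<close>

lemma deflate:
  "psd_operator (\<lambda>y. A y - ((A u \<bullet> y) / (u \<bullet> A u)) *\<^sub>R A u)"
proof (rule psd_operator.intro)
  show "linear (\<lambda>y. A y - ((A u \<bullet> y) / (u \<bullet> A u)) *\<^sub>R A u)"
    by (rule linearI) (simp_all add: linear_add[OF linear] linear_scale[OF linear]
        inner_add_right algebra_simps add_divide_distrib)
  show "x \<bullet> (A y - ((A u \<bullet> y) / (u \<bullet> A u)) *\<^sub>R A u) = y \<bullet> (A x - ((A u \<bullet> x) / (u \<bullet> A u)) *\<^sub>R A u)"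
    for x y using sym[of x y] by (simp add: inner_diff_right inner_commute)
  show "0 \<le> x \<bullet> (A x - ((A u \<bullet> x) / (u \<bullet> A u)) *\<^sub>R A u)" for x
  proof (cases "u \<bullet> A u = 0")
    case True
    then show ?thesis by (simp add: nonneg)
  next
    case False
    then have "u \<bullet> A u > 0" using nonneg[of u] by linarith
    then show ?thesis
      using Cauchy_Schwarz[of x u]
      by (simp add: inner_diff_right inner_commute power2_eq_square field_simps)
  qed
qed

end

text \<open>Lagrange's reduction: subtracting \<open>(A u \<bullet> x)\<^sup>2 / (u \<bullet> A u)\<close> puts the basis vector \<open>u\<close> into
  the kernel and keeps there those already handled.\<close>

lemma psd_operator_sum_squares_aux:
  fixes A :: "'a :: euclidean_space \<Rightarrow> 'a"
  assumes "finite I" "I \<subseteq> Basis" "psd_operator A" "\<And>b. b \<in> Basis - I \<Longrightarrow> A b = 0"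
  shows "\<exists>(r :: nat) v. \<forall>x. x \<bullet> A x = (\<Sum>k<r. (v k \<bullet> x)\<^sup>2)"
  using assms
proof (induction I arbitrary: A rule: finite_induct)
  case empty
  interpret psd_operator A by fact
  have "A x = 0" for x
    using linear_eq_stdbasis[OF linear linear_zero] empty by (simp add: fun_eq_iff)
  then show ?case by (intro exI[of _ 0]) simp
next
  case (insert u I)
  interpret psd_operator A by fact
  show ?case
  proof (cases "u \<bullet> A u = 0")
    case True
    \<comment> \<open>Then \<open>u\<close> lies in the kernel already and no square is split
      off.\<close>
    then have "A u = 0" by (rule null_vector)
    then show ?thesis using insert by (intro insert.IH) auto
  next
    case False
    then have pos: "u \<bullet> A u > 0" using nonneg[of u] by linarith
    define B where "B y = A y - ((A u \<bullet> y) / (u \<bullet> A u)) *\<^sub>R A u" for y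
    have "psd_operator B" using deflate[of u] by (simp add: B_def[abs_def])
    moreover have "B b = 0" if "b \<in> Basis - I" for b
    proof (cases "b = u")
      case True
      then show ?thesis using False by (simp add: B_def inner_commute)
    next
      case False
      \<comment> \<open>By symmetry \<open>A u \<bullet> b = u \<bullet> A b = 0\<close>, so the
        subtracted term vanishes at \<open>b\<close> too.\<close>
      then have "A b = 0" using that insert by auto
      then show ?thesis using sym[of u b] by (simp add: B_def inner_commute)
    qed
    ultimately obtain r v where rv: "\<And>x. x \<bullet> B x = (\<Sum>k<(r::nat). (v k \<bullet> x)\<^sup>2)"
      using insert.IH[of B] insert.prems by auto
    \<comment> \<open>Scaled so that the square of \<open>w \<bullet> x\<close> is exactly the term
      subtracted in \<open>B\<close>.\<close>
    define w where "w = (1 / sqrt (u \<bullet> A u)) *\<^sub>R A u"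
    have "x \<bullet> A x = (\<Sum>k<Suc r. ((v(r := w)) k \<bullet> x)\<^sup>2)" for x
    proof -
      have "(w \<bullet> x)\<^sup>2 = (A u \<bullet> x)\<^sup>2 / (u \<bullet> A u)"
        using pos by (simp add: w_def power_mult_distrib power_divide)
      moreover have "x \<bullet> B x = x \<bullet> A x - (A u \<bullet> x)\<^sup>2 / (u \<bullet> A u)"
        by (simp add: B_def inner_diff_right inner_commute power2_eq_square)
      ultimately show ?thesis using rv[of x] by simp
    qed
    then show ?thesis by blast
  qed
qed

lemma psd_operator_sum_squares:
  assumes "psd_operator A"
  obtains r :: nat and v where "\<And>x. x \<bullet> A x = (\<Sum>k<r. (v k \<bullet> x)\<^sup>2)"
  using psd_operator_sum_squares_aux[OF finite_Basis order_refl assms] by auto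

lemma symmetric_inner_matrix:
  fixes M :: "real ^ 'n ^ 'n"
  assumes "transpose M = M"
  shows "x \<bullet> (M *v y) = y \<bullet> (M *v x)"
  using dot_lmul_matrix[of x M y] assms by (metis inner_commute transpose_matrix_vector)

lemma inner_matrix_sum:
  fixes M :: "real ^ 'n ^ 'n"
  shows "v \<bullet> (M *v v) = (\<Sum>i\<in>UNIV. \<Sum>j\<in>UNIV. v $ i * M $ i $ j * v $ j)"
  by (simp add: inner_vec_def matrix_vector_mult_def sum_distrib_left mult.assoc)

lemma psd_iff:
  fixes M :: "real ^ 'n ^ 'n"
  shows "psd M \<longleftrightarrow> transpose M = M \<and> (\<forall>v. 0 \<le> v \<bullet> (M *v v))"
proof -
  have "transpose M = M \<longleftrightarrow> (\<forall>i j. M $ i $ j = M $ j $ i)"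
    by (auto simp: transpose_def vec_eq_iff)
  moreover have "(\<forall>v. 0 \<le> (\<Sum>i\<in>UNIV. \<Sum>j\<in>UNIV. v i * M $ i $ j * v j)) \<longleftrightarrow>
      (\<forall>v. 0 \<le> v \<bullet> (M *v v))"
    unfolding inner_matrix_sum
  proof (intro iffI allI)
    fix v assume "\<forall>v :: real ^ 'n. 0 \<le> (\<Sum>i\<in>UNIV. \<Sum>j\<in>UNIV. v $ i * M $ i $ j * v $ j)"
    from spec[OF this, of "\<chi> i. v i"]
    show "0 \<le> (\<Sum>i\<in>UNIV. \<Sum>j\<in>UNIV. v i * M $ i $ j * v j)" by simp
  qed auto
  ultimately show ?thesis unfolding psd_def psd_on_def by auto
qed

lemma psd_operator_matrix:
  fixes M :: "real ^ 'n ^ 'n"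
  assumes "psd M"
  shows "psd_operator ((*v) M)"
  using assms symmetric_inner_matrix[of M] unfolding psd_iff
  by (intro psd_operator.intro) auto

text \<open>The trace of \<open>R^T R M\<close> is the sum of the values of the form
  \<open>M\<close> at the rows of \<open>R\<close>. This yields both its nonnegativity for psd
  \<open>M\<close> and its value for the feasible \<open>S\<close> of rank at most one.\<close>

lemma trace_sos_matrix_mult:
  fixes S M :: "real ^ 'n ^ 'n"
  assumes "\<And>i j. S $ i $ j = (\<Sum>k<(r::nat). R k i * R k j)" "transpose M = M"
  shows "trace (S ** M) = (\<Sum>k<r. (\<chi> i. R k i) \<bullet> (M *v (\<chi> i. R k i)))"
proof -
  have sym: "M $ i $ j = M $ j $ i" for i j
    using assms(2) by (metis transpose_def vec_lambda_beta)
  have "trace (S ** M) = (\<Sum>i\<in>UNIV. \<Sum>j\<in>UNIV. \<Sum>k<r. R k i * M $ i $ j * R k j)"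
    unfolding trace_def matrix_matrix_mult_def assms(1)
    by (simp add: sum_distrib_right sum_distrib_left mult_ac sym)
  also have "\<dots> = (\<Sum>i\<in>UNIV. \<Sum>k<r. \<Sum>j\<in>UNIV. R k i * M $ i $ j * R k j)"
    by (intro sum.cong refl sum.swap)
  also have "\<dots> = (\<Sum>k<r. \<Sum>i\<in>UNIV. \<Sum>j\<in>UNIV. R k i * M $ i $ j * R k j)"
    by (rule sum.swap)
  finally show ?thesis by (simp add: inner_matrix_sum)
qed

section \<open>Spectrahedra\<close>

text \<open>Test vectors are transported along \<open>f\<close> and its inverse. This frees the
  matrices of a spectrahedron from indices of the form \<open>{..<m}\<close>.\<close>

lemma psd_on_bij_betw:
  assumes f: "bij_betw f J I"
  shows "psd_on J (\<lambda>a b. M (f a) (f b)) \<longleftrightarrow> psd_on I M"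
proof -
  have img: "f ` J = I" using f by (simp add: bij_betw_def)
  have sums: "(\<Sum>i\<in>I. \<Sum>j\<in>I. v i * M i j * v j) = (\<Sum>a\<in>J. \<Sum>b\<in>J. v (f a) * M (f a) (f b) * v (f b))" for v
    by (simp add: sum.reindex_bij_betw[OF f, symmetric])
  have sums': "(\<Sum>a\<in>J. \<Sum>b\<in>J. v a * M (f a) (f b) * v b) =
    (\<Sum>i\<in>I. \<Sum>j\<in>I. v (the_inv_into J f i) * M i j * v (the_inv_into J f j))" for v
    unfolding sums using f
    by (intro sum.cong refl) (simp add: the_inv_into_f_f bij_betw_def)
  have "(\<forall>v. 0 \<le> (\<Sum>a\<in>J. \<Sum>b\<in>J. v a * M (f a) (f b) * v b)) \<longleftrightarrow>
        (\<forall>v. 0 \<le> (\<Sum>i\<in>I. \<Sum>j\<in>I. v i * M i j * v j))"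
  proof (intro iffI allI)
    fix v assume "\<forall>v. 0 \<le> (\<Sum>a\<in>J. \<Sum>b\<in>J. v a * M (f a) (f b) * v b)"
    then show "0 \<le> (\<Sum>i\<in>I. \<Sum>j\<in>I. v i * M i j * v j)"
      unfolding sums by (rule allE[of _ "\<lambda>a. v (f a)"])
  next
    fix v assume "\<forall>v. 0 \<le> (\<Sum>i\<in>I. \<Sum>j\<in>I. v i * M i j * v j)"
    then show "0 \<le> (\<Sum>a\<in>J. \<Sum>b\<in>J. v a * M (f a) (f b) * v b)"
      unfolding sums' by (rule allE[of _ "\<lambda>i. v (the_inv_into J f i)"])
  qed
  then show ?thesis unfolding psd_on_def img[symmetric] by auto
qed

lemma spectrahedronI:
  fixes I :: "'i set" and A :: "'n :: finite \<Rightarrow> 'i \<Rightarrow> 'i \<Rightarrow> real"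
  assumes "finite I"
    and "\<And>a b. a \<in> I \<Longrightarrow> b \<in> I \<Longrightarrow> A0 a b = A0 b a"
    and "\<And>i a b. a \<in> I \<Longrightarrow> b \<in> I \<Longrightarrow> A i a b = A i b a"
  shows "spectrahedron {x :: real ^ 'n. psd_on I (\<lambda>a b. A0 a b + (\<Sum>i\<in>UNIV. x $ i * A i a b))}"
proof -
  obtain f where f: "bij_betw f {..<card I} I"
    using ex_bij_betw_nat_finite[OF assms(1)] by (auto simp: atLeast0LessThan)
  then have "f a \<in> I" if "a < card I" for a
    using that by (auto simp: bij_betw_def)
  then show ?thesis
    unfolding spectrahedron_def
    using assms(2,3) psd_on_bij_betw[OF f, of "\<lambda>a b. A0 a b + (\<Sum>i\<in>UNIV. _ $ i * A i a b)"]
    by (intro exI[of _ "card I"] exI[of _ "\<lambda>a b. A0 (f a) (f b)"]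
        exI[of _ "\<lambda>i a b. A i (f a) (f b)"]) auto
qed

text \<open>A 0 by 0 matrix is positive semidefinite.\<close>

lemma spectrahedron_UNIV: "spectrahedron (UNIV :: (real ^ 'n) set)"
  using spectrahedronI[of "{} :: nat set" "\<lambda>_ _. 0" "\<lambda>_ _ _. 0"] by (simp add: psd_on_def)

text \<open>The matrix is 1 by 1 with entry \<open>a \<bullet> x - b\<close>.\<close>

lemma spectrahedron_halfspace: "spectrahedron {x :: real ^ 'n. b \<le> a \<bullet> x}"
proof -
  have "psd_on {()} (\<lambda>_ _. - b + (\<Sum>i\<in>UNIV. x $ i * a $ i)) \<longleftrightarrow> b \<le> a \<bullet> x" for x :: "real ^ 'n"
  proof -
    have "(\<Sum>i\<in>UNIV. x $ i * a $ i) = a \<bullet> x"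
      by (simp add: inner_vec_def mult.commute)
    moreover have "(\<forall>v :: unit \<Rightarrow> real. 0 \<le> v () * c * v ()) \<longleftrightarrow> 0 \<le> c" for c
      by (auto dest: spec[of _ "\<lambda>_. 1"] simp: mult.commute[of _ c] mult.assoc)
    ultimately show ?thesis by (simp add: psd_on_def)
  qed
  then show ?thesis
    using spectrahedronI[of "{()}" "\<lambda>_ _. - b" "\<lambda>i _ _. a $ i"] by simp
qed

text \<open>Indexing by a sum type avoids offsets; \<open>spectrahedronI\<close> returns to natural
  number indices.\<close>

fun block_diag :: "('i \<Rightarrow> 'i \<Rightarrow> 'c :: zero) \<Rightarrow> ('j \<Rightarrow> 'j \<Rightarrow> 'c) \<Rightarrow> 'i + 'j \<Rightarrow> 'i + 'j \<Rightarrow> 'c" where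
  "block_diag M N (Inl a) (Inl b) = M a b"
| "block_diag M N (Inr a) (Inr b) = N a b"
| "block_diag M N (Inl a) (Inr b) = 0"
| "block_diag M N (Inr a) (Inl b) = 0"

lemma psd_on_block_diag:
  assumes "finite I" "finite J"
  shows "psd_on (I <+> J) (block_diag M N) \<longleftrightarrow> psd_on I M \<and> psd_on J N"
proof -
  have sums: "(\<Sum>a\<in>I <+> J. \<Sum>b\<in>I <+> J. v a * block_diag M N a b * v b) =
      (\<Sum>a\<in>I. \<Sum>b\<in>I. v (Inl a) * M a b * v (Inl b)) +
      (\<Sum>a\<in>J. \<Sum>b\<in>J. v (Inr a) * N a b * v (Inr b))" for v
    using assms by (simp add: sum.Plus)
  have "(\<forall>v. 0 \<le> (\<Sum>a\<in>I <+> J. \<Sum>b\<in>I <+> J. v a * block_diag M N a b * v b)) \<longleftrightarrow>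
      (\<forall>v. 0 \<le> (\<Sum>a\<in>I. \<Sum>b\<in>I. v a * M a b * v b)) \<and>
      (\<forall>v. 0 \<le> (\<Sum>a\<in>J. \<Sum>b\<in>J. v a * N a b * v b))" (is "?L \<longleftrightarrow> ?R1 \<and> ?R2")
  proof
    assume ?L
    then have nonneg: "0 \<le> (\<Sum>a\<in>I. \<Sum>b\<in>I. v (Inl a) * M a b * v (Inl b)) +
      (\<Sum>a\<in>J. \<Sum>b\<in>J. v (Inr a) * N a b * v (Inr b))" for v
      unfolding sums by blast
    show "?R1 \<and> ?R2"
    proof (intro conjI allI)
      \<comment> \<open>Extending a test vector by zero on the other block isolates one
        summand.\<close>
      show "0 \<le> (\<Sum>a\<in>I. \<Sum>b\<in>I. v a * M a b * v b)" for v
        using nonneg[of "case_sum v (\<lambda>_. 0)"] by simp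
      show "0 \<le> (\<Sum>a\<in>J. \<Sum>b\<in>J. v a * N a b * v b)" for v
        using nonneg[of "case_sum (\<lambda>_. 0) v"] by simp
    qed
  next
    assume R: "?R1 \<and> ?R2"
    show ?L
    proof
      fix v
      show "0 \<le> (\<Sum>a\<in>I <+> J. \<Sum>b\<in>I <+> J. v a * block_diag M N a b * v b)"
        unfolding sums
        using conjunct1[OF R, rule_format, of "\<lambda>a. v (Inl a)"]
          conjunct2[OF R, rule_format, of "\<lambda>a. v (Inr a)"]
        by (rule add_nonneg_nonneg)
    qed
  qed
  moreover have "(\<forall>a\<in>I <+> J. \<forall>b\<in>I <+> J. block_diag M N a b = block_diag M N b a) \<longleftrightarrow>
     (\<forall>a\<in>I. \<forall>b\<in>I. M a b = M b a) \<and> (\<forall>a\<in>J. \<forall>b\<in>J. N a b = N b a)"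
    by (simp add: Plus_def ball_Un)
  ultimately show ?thesis unfolding psd_on_def by blast
qed

lemma spectrahedron_Int:
  fixes X Y :: "(real ^ 'n) set"
  assumes "spectrahedron X" "spectrahedron Y"
  shows "spectrahedron (X \<inter> Y)"
proof -
  obtain m :: nat and A0 A where A: "\<forall>a<m. \<forall>b<m. A0 a b = A0 b a"
    "\<forall>i. \<forall>a<m. \<forall>b<m. A i a b = A i b a"
    "X = {x. psd_on {..<m} (\<lambda>a b. A0 a b + (\<Sum>i\<in>UNIV. x $ i * A i a b))}"
    using assms(1) unfolding spectrahedron_def by (elim exE conjE)
  obtain l :: nat and B0 B where B: "\<forall>a<l. \<forall>b<l. B0 a b = B0 b a"
    "\<forall>i. \<forall>a<l. \<forall>b<l. B i a b = B i b a"
    "Y = {x. psd_on {..<l} (\<lambda>a b. B0 a b + (\<Sum>i\<in>UNIV. x $ i * B i a b))}"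
    using assms(2) unfolding spectrahedron_def by (elim exE conjE)
  have "block_diag A0 B0 a b + (\<Sum>i\<in>UNIV. x $ i * block_diag (A i) (B i) a b) =
      block_diag (\<lambda>a b. A0 a b + (\<Sum>i\<in>UNIV. x $ i * A i a b))
        (\<lambda>a b. B0 a b + (\<Sum>i\<in>UNIV. x $ i * B i a b)) a b" for x :: "real ^ 'n" and a b
    by (cases a; cases b) simp_all
  then have "X \<inter> Y = {x. psd_on ({..<m} <+> {..<l})
      (\<lambda>a b. block_diag A0 B0 a b + (\<Sum>i\<in>UNIV. x $ i * block_diag (A i) (B i) a b))}"
    by (auto simp: A(3) B(3) psd_on_block_diag)
  moreover have "spectrahedron \<dots>"
    by (rule spectrahedronI) (auto simp: A(1,2) B(1,2))
  ultimately show ?thesis by simp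
qed

text \<open>An affine subspace is a finite intersection of hyperplanes, and each hyperplane is the
  intersection of two halfspaces. The empty intersection is the whole space.\<close>

lemma spectrahedron_affine_hull: "spectrahedron (affine hull X)" for X :: "(real ^ 'n) set"
proof -
  obtain F where F: "finite F" "affine hull X = \<Inter>F"
    "\<And>h. h \<in> F \<Longrightarrow> \<exists>a b. a \<noteq> 0 \<and> h = {x. a \<bullet> x = b}"
    by (rule affine_hull_finite_intersection_hyperplanes[of X]) (rule that)
  have hyper: "spectrahedron h" if h: "h \<in> F" for h
  proof -
    obtain a b where "h = {x. a \<bullet> x = b}" using F(3)[OF h] by blast
    then have "h = {x. b \<le> a \<bullet> x} \<inter> {x. - b \<le> (- a) \<bullet> x}" by auto
    then show ?thesis by (metis spectrahedron_Int spectrahedron_halfspace)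
  qed
  have "spectrahedron (\<Inter>F)"
    using F(1) hyper by (induction F rule: finite_induct) (auto intro: spectrahedron_UNIV spectrahedron_Int)
  then show ?thesis using F(2) by simp
qed

section \<open>Cubic polynomials\<close>

text \<open>\<open>C\<close> encodes a symmetric trilinear form: \<open>x \<bullet> (C y *v z)\<close> is invariant under all permutations
  of \<open>x\<close>, \<open>y\<close>, \<open>z\<close>.\<close>

locale cubic_expansion =
  fixes p :: "real ^ 'n \<Rightarrow> real" and c :: real and g :: "real ^ 'n" and h :: "real ^ 'n ^ 'n"
    and C :: "real ^ 'n \<Rightarrow> real ^ 'n ^ 'n"
  assumes p_eq: "p x = c + g \<bullet> x + (1/2) * (x \<bullet> (h *v x)) + (1/6) * (x \<bullet> (C x *v x))"
    and h_sym: "transpose h = h"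
    and linear_C: "linear C"
    and C_sym: "transpose (C x) = C x"
    and C_commute: "C x *v y = C y *v x"
begin

text \<open>The factor 1/2 arises because the symmetric cubic term with coefficient 1/6 contributes
  three equal terms to the derivative.\<close>

definition grad :: "real ^ 'n \<Rightarrow> real ^ 'n" where
  "grad x = g + h *v x + (1/2) *\<^sub>R (C x *v x)"

definition H :: "real ^ 'n \<Rightarrow> real ^ 'n ^ 'n" where
  "H x = h + C x"

lemmas C_add = linear_add[OF linear_C]
lemmas C_scale = linear_scale[OF linear_C]

lemma H_sym: "transpose (H x) = H x"
  using h_sym C_sym[of x] by (simp add: H_def transpose_def vec_eq_iff)

section \<open>Gradient and Hessian of the cubic\<close>

lemma bounded_bilinear_C: "bounded_bilinear (\<lambda>x y. C x *v y)"
proof -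
  have "linear (\<lambda>y. C x *v y)" for x by simp
  then have "bilinear (\<lambda>x y. C x *v y)"
    unfolding bilinear_def using C_commute by simp
  then show ?thesis by (simp add: bilinear_conv_bounded_bilinear)
qed

lemma has_derivative_quadratic:
  "((\<lambda>x. C x *v x) has_derivative (\<lambda>y. 2 *\<^sub>R (C x *v y))) (at x)"
proof (rule has_derivative_eq_rhs)
  show "((\<lambda>x. C x *v x) has_derivative (\<lambda>y. C x *v y + C y *v x)) (at x)"
    by (rule bounded_bilinear.FDERIV[OF bounded_bilinear_C has_derivative_ident has_derivative_ident])
  show "(\<lambda>y. C x *v y + C y *v x) = (\<lambda>y. 2 *\<^sub>R (C x *v y))"
    by (simp add: C_commute[of _ x] scaleR_2)
qed

lemma has_derivative_linear_part: "((\<lambda>x. h *v x) has_derivative (\<lambda>y. h *v y)) (at x)"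
  by (intro linear_imp_has_derivative) simp

lemma has_derivative_p: "(p has_derivative (\<lambda>y. grad x \<bullet> y)) (at x)"
proof (rule has_derivative_eq_rhs)
  show "(p has_derivative (\<lambda>y. 0 + g \<bullet> y + (1/2) * (x \<bullet> (h *v y) + y \<bullet> (h *v x)) +
      (1/6) * (x \<bullet> (2 *\<^sub>R (C x *v y)) + y \<bullet> (C x *v x)))) (at x)"
    unfolding p_eq[abs_def]
    by (intro has_derivative_add has_derivative_const has_derivative_mult_right
        has_derivative_inner has_derivative_inner_right has_derivative_ident
        has_derivative_linear_part has_derivative_quadratic)
  show "(\<lambda>y. 0 + g \<bullet> y + (1/2) * (x \<bullet> (h *v y) + y \<bullet> (h *v x)) +
      (1/6) * (x \<bullet> (2 *\<^sub>R (C x *v y)) + y \<bullet> (C x *v x))) = (\<lambda>y. grad x \<bullet> y)"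
    using symmetric_inner_matrix[OF h_sym, of x] symmetric_inner_matrix[OF C_sym, of x x]
    by (simp add: grad_def inner_add_left inner_add_right inner_commute fun_eq_iff)
qed

lemma has_derivative_grad: "(grad has_derivative (\<lambda>y. H x *v y)) (at x)"
proof (rule has_derivative_eq_rhs)
  show "(grad has_derivative (\<lambda>y. 0 + h *v y + (1/2) *\<^sub>R (2 *\<^sub>R (C x *v y)))) (at x)"
    unfolding grad_def[abs_def]
    by (intro has_derivative_add has_derivative_const has_derivative_scaleR_right
        has_derivative_linear_part has_derivative_quadratic)
  show "(\<lambda>y. 0 + h *v y + (1/2) *\<^sub>R (2 *\<^sub>R (C x *v y))) = (\<lambda>y. H x *v y)"
    by (simp add: H_def matrix_vector_mult_add_rdistrib)
qed

lemma partial_deriv_p: "partial_deriv i p = (\<lambda>x. grad x $ i)"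
proof
  show "partial_deriv i p x = grad x $ i" for x
    unfolding partial_deriv_def frechet_derivative_at[OF has_derivative_p, symmetric]
    by (simp add: inner_axis)
qed

lemma gradient_p: "gradient p x = grad x"
  by (simp add: gradient_def partial_deriv_p vec_eq_iff)

lemma hessian_p: "hessian p x = H x"
proof -
  have "partial_deriv i (\<lambda>x. grad x $ j) x = H x $ i $ j" for i j
  proof -
    have "((\<lambda>x. grad x $ j) has_derivative (\<lambda>y. (H x *v y) $ j)) (at x)"
      by (rule bounded_linear.has_derivative[OF bounded_linear_vec_nth has_derivative_grad])
    \<comment> \<open>Differentiating component \<open>j\<close> in direction \<open>i\<close> gives
      the entry in row \<open>j\<close>, column \<open>i\<close>, hence the transpose.\<close>
    then have "partial_deriv i (\<lambda>x. grad x $ j) x = transpose (H x) $ i $ j"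
      unfolding partial_deriv_def
      by (simp add: frechet_derivative_at[symmetric] matrix_vector_mult_basis column_def transpose_def)
    then show ?thesis by (simp only: H_sym)
  qed
  then show ?thesis by (simp add: hessian_def partial_deriv_p vec_eq_iff)
qed

lemma second_order_points_iff: "x \<in> second_order_points p \<longleftrightarrow> grad x = 0 \<and> psd (H x)"
  by (simp add: second_order_points_def gradient_p hessian_p)

section \<open>Taylor expansion at an arbitrary point\<close>

lemma H_shift: "H (a + y) = H a + C y"
  by (simp add: H_def C_add)

lemma grad_shift: "grad (a + y) = grad a + H a *v y + (1/2) *\<^sub>R (C y *v y)"
  by (simp add: grad_def H_def C_add matrix_vector_mult_add_rdistrib matrix_vector_right_distrib
      C_commute[of y a] scaleR_add_right)

text \<open>The expansion is exact since the degree is at most 3. Symmetry of the trilinear form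
  merges its mixed terms into two groups of three equal ones.\<close>

lemma p_shift:
  "p (a + y) = p a + grad a \<bullet> y + (1/2) * (y \<bullet> (H a *v y)) + (1/6) * (y \<bullet> (C y *v y))"
proof -
  have "a \<bullet> (h *v y) = y \<bullet> (h *v a)"
    by (rule symmetric_inner_matrix[OF h_sym])
  moreover have "a \<bullet> (C a *v y) = y \<bullet> (C a *v a)"
    by (rule symmetric_inner_matrix[OF C_sym])
  moreover have "a \<bullet> (C y *v y) = y \<bullet> (C a *v y)"
    using symmetric_inner_matrix[OF C_sym, of a y y] by (simp add: C_commute[of y a])
  ultimately have "(a + y) \<bullet> (h *v (a + y)) = a \<bullet> (h *v a) + 2 * (y \<bullet> (h *v a)) + y \<bullet> (h *v y)"
    "(a + y) \<bullet> (C (a + y) *v (a + y)) = a \<bullet> (C a *v a) + 3 * (y \<bullet> (C a *v a)) +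
      3 * (y \<bullet> (C a *v y)) + y \<bullet> (C y *v y)"
    by (simp_all only: C_add matrix_vector_mult_add_rdistrib matrix_vector_right_distrib
        C_commute[of y a] inner_add_left inner_add_right)
  then show ?thesis
    by (simp add: p_eq grad_def H_def matrix_vector_mult_add_rdistrib inner_add_left
        inner_add_right inner_commute[of _ y] add_divide_distrib)
qed

lemma psd_H_nonneg: "0 \<le> y \<bullet> (H x *v y)" if "psd (H x)"
  using that by (simp add: psd_iff)

lemma psd_H_null: "H x *v y = 0" if "psd (H x)" "y \<bullet> (H x *v y) = 0"
  using psd_operator.null_vector[OF psd_operator_matrix[OF that(1)] that(2)] .

lemma inner_H_shift: "y \<bullet> (H (a + y) *v y) = y \<bullet> (H a *v y) + y \<bullet> (C y *v y)"
  by (simp add: H_shift matrix_vector_mult_add_rdistrib inner_add_right)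

section \<open>Second-order points as a level set on the region of psd Hessian\<close>

context
  fixes a y :: "real ^ 'n"
  assumes a: "a \<in> second_order_points p" and psd_y: "psd (H (a + y))"
begin

text \<open>Let \<open>q = y \<bullet> (H a *v y)\<close> and
  \<open>s = y \<bullet> (C y *v y)\<close>. The gradient at \<open>a + y\<close> paired with
  \<open>y\<close> gives \<open>s = - 2 q\<close>. As \<open>q\<close> and \<open>q + s\<close> are
  nonnegative, both \<open>q\<close> and \<open>s\<close> are 0, and so is
  \<open>p (a + y) - p a = q/2 + s/6\<close>.\<close>

lemma second_order_point_value: "p (a + y) = p a" if "a + y \<in> second_order_points p"
proof -
  have "grad a = 0" "psd (H a)" "grad (a + y) = 0"
    using a that by (auto simp: second_order_points_iff)
  then have "y \<bullet> (H a *v y) + (1/2) * (y \<bullet> (C y *v y)) = 0"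
    using grad_shift[of a y] by (metis add_0 inner_add_right inner_scaleR_right inner_zero_right)
  then show ?thesis
    using p_shift[of a y] \<open>grad a = 0\<close> psd_H_nonneg[OF \<open>psd (H a)\<close>, of y]
      psd_H_nonneg[OF psd_y, of y] inner_H_shift[of y a]
    by simp
qed

lemma null_of_value: "H a *v y = 0 \<and> C y *v y = 0" if "p (a + y) = p a"
proof -
  have SO: "grad a = 0" "psd (H a)"
    using a by (auto simp: second_order_points_iff)
  \<comment> \<open>Equal values give
    \<open>y \<bullet> (C y *v y) = - 3 (y \<bullet> (H a *v y))\<close>, so the two nonnegative
    forms at \<open>y\<close> are \<open>q\<close> and \<open>- 2 q\<close> with
    \<open>q = y \<bullet> (H a *v y)\<close>.\<close>
  have "y \<bullet> (H a *v y) = 0" "y \<bullet> (H (a + y) *v y) = 0"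
    using p_shift[of a y] that SO psd_H_nonneg[OF \<open>psd (H a)\<close>, of y]
      psd_H_nonneg[OF psd_y, of y] inner_H_shift[of y a]
    by simp_all
  then have "H a *v y = 0" "H (a + y) *v y = 0"
    using psd_H_null SO(2) psd_y by blast+
  then show ?thesis by (simp add: H_shift matrix_vector_mult_add_rdistrib)
qed

lemma second_order_point_of_null:
  "a + y \<in> second_order_points p" if "H a *v y = 0 \<and> C y *v y = 0"
  using that a psd_y by (simp add: second_order_points_iff grad_shift)

end

lemma second_order_points_null:
  assumes "a \<in> second_order_points p" "a + y \<in> second_order_points p"
  shows "H a *v y = 0" "C y *v y = 0"
proof -
  have "psd (H (a + y))" using assms(2) by (simp add: second_order_points_iff)
  then show "H a *v y = 0" "C y *v y = 0"
    using null_of_value[OF assms(1)] second_order_point_value[OF assms(1)] assms(2) by blast+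
qed

lemma second_order_points_eq_level:
  assumes "a \<in> second_order_points p"
  shows "second_order_points p = {x. psd (H x) \<and> p x = p a}"
proof (intro set_eqI iffI; clarsimp)
  fix x assume "x \<in> second_order_points p"
  then show "psd (H x) \<and> p x = p a"
    using second_order_point_value[OF assms, of "x - a"] by (simp add: second_order_points_iff)
next
  fix x assume "psd (H x)" "p x = p a"
  then show "x \<in> second_order_points p"
    using second_order_point_of_null[OF assms, of "x - a"] null_of_value[OF assms, of "x - a"] by simp
qed

section \<open>The affine hull of the second-order points\<close>

lemma second_order_points_midpoint:
  assumes "a \<in> second_order_points p" "a + y \<in> second_order_points p"
  shows "a + (1/2) *\<^sub>R y \<in> second_order_points p"
proof (rule second_order_point_of_null[OF assms(1)])
  have psd: "psd (H a)" "psd (H (a + y))"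
    using assms by (auto simp: second_order_points_iff)
  \<comment> \<open>The Hessian is affine in the point, so at the midpoint it is the average of the
    Hessians at the ends.\<close>
  have "0 \<le> v \<bullet> (H (a + (1/2) *\<^sub>R y) *v v)" for v
    using psd_H_nonneg[OF psd(1), of v] psd_H_nonneg[OF psd(2), of v]
    by (simp add: H_shift C_scale matrix_vector_mult_add_rdistrib inner_add_right
        scaleR_matrix_vector_assoc[symmetric])
  then show "psd (H (a + (1/2) *\<^sub>R y))" by (simp add: psd_iff H_sym)
  show "H a *v ((1/2) *\<^sub>R y) = 0 \<and> C ((1/2) *\<^sub>R y) *v ((1/2) *\<^sub>R y) = 0"
    using second_order_points_null[OF assms]
    by (simp add: C_scale matrix_vector_mult_scaleR scaleR_matrix_vector_assoc[symmetric])
qed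

text \<open>The midpoint of \<open>a + y\<close> and \<open>a + z\<close> makes
  \<open>C (y + z) *v (y + z)\<close> vanish; removing the two pure terms leaves twice the mixed
  one. The midpoint is taken because \<open>a + y + z\<close> is not known to be a second-order
  point.\<close>

lemma second_order_points_polarize:
  assumes a: "a \<in> second_order_points p"
    and "a + y \<in> second_order_points p" "a + z \<in> second_order_points p"
  shows "C y *v z = 0"
proof -
  have "(a + y) + (1/2) *\<^sub>R (z - y) \<in> second_order_points p"
    using assms by (intro second_order_points_midpoint) simp_all
  also have "(a + y) + (1/2) *\<^sub>R (z - y) = a + (1/2) *\<^sub>R (y + z)"
    by (simp add: vec_eq_iff field_simps)
  finally have "C ((1/2) *\<^sub>R (y + z)) *v ((1/2) *\<^sub>R (y + z)) = 0"
    using second_order_points_null(2)[OF a] by blast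
  then have "C (y + z) *v (y + z) = 0"
    by (simp add: C_scale matrix_vector_mult_scaleR scaleR_matrix_vector_assoc[symmetric]
        del: scaleR_add_right)
  then have "2 *\<^sub>R (C y *v z) = 0"
    using second_order_points_null(2)[OF a] assms(2,3)
    by (simp add: C_add matrix_vector_mult_add_rdistrib matrix_vector_right_distrib
        C_commute[of z y] scaleR_2)
  then show ?thesis by simp
qed

lemma second_order_points_eq_affine_hull:
  "second_order_points p = affine hull (second_order_points p) \<inter> {x. psd (H x)}"
proof (intro set_eqI iffI)
  fix x assume "x \<in> affine hull (second_order_points p) \<inter> {x. psd (H x)}"
  then have x: "x \<in> affine hull (second_order_points p)" "psd (H x)" by auto
  then have "second_order_points p \<noteq> {}" by auto
  then obtain a where a: "a \<in> second_order_points p" by blast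
  \<comment> \<open>Translating \<open>a\<close> to the origin turns the affine hull into a linear
    span.\<close>
  let ?Y = "(\<lambda>x. - a + x) ` second_order_points p"
  have Y: "a + y \<in> second_order_points p" if "y \<in> ?Y" for y
    using that by auto
  obtain y where y: "x = a + y" "y \<in> span ?Y"
    using x(1) affine_hull_span_gen[OF hull_inc[OF a]] by auto
  have "linear (\<lambda>y. C z *v y)" for z by simp
  then have C_left: "linear (\<lambda>z. C z *v y)" for y by (simp add: C_commute[of _ y])
  \<comment> \<open>Bilinear extension from \<open>?Y\<close> to its span: first in the second
    argument with \<open>z\<close> in \<open>?Y\<close>, then in the first argument.\<close>
  have 1: "C z *v y = 0" if "z \<in> ?Y" for z
    using linear_eq_on_span[OF _ linear_zero, of "\<lambda>y. C z *v y" ?Y y] y(2)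
      second_order_points_polarize[OF a Y[OF that] Y] by simp
  have "C y *v y = 0"
    using linear_eq_on_span[OF C_left linear_zero, of ?Y y y] y(2) 1 by simp
  moreover have "H a *v y = 0"
    using linear_eq_on_span[OF _ linear_zero, of "\<lambda>y. H a *v y" ?Y y] y(2)
      second_order_points_null(1)[OF a Y] by simp
  ultimately show "x \<in> second_order_points p"
    using second_order_point_of_null[OF a] x(2) y(1) by blast
qed (auto simp: second_order_points_iff hull_inc)

lemma spectrahedron_psd_H: "spectrahedron {x. psd (H x)}"
proof -
  \<comment> \<open>Expanding \<open>C x\<close> in the standard basis shows the matrices that
    define the spectrahedron.\<close>
  have C_sum: "C x = (\<Sum>i\<in>UNIV. x $ i *\<^sub>R C (axis i 1))" for x
  proof -
    have "C x = C (\<Sum>i\<in>UNIV. x $ i *\<^sub>R axis i 1)"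
      by (simp add: basis_expansion[of x, unfolded scalar_mult_eq_scaleR])
    then show ?thesis by (simp add: linear_sum[OF linear_C] C_scale)
  qed
  have entry: "H x $ i $ j = h $ i $ j + (\<Sum>k\<in>UNIV. x $ k * C (axis k 1) $ i $ j)" for x i j
    unfolding H_def by (subst C_sum) simp
  have "h $ i $ j = h $ j $ i" "C x $ i $ j = C x $ j $ i" for i j x
    using h_sym C_sym by (metis transpose_def vec_lambda_beta)+
  then show ?thesis
    unfolding psd_def entry by (intro spectrahedronI) simp_all
qed

lemma spectrahedron_second_order_points: "spectrahedron (second_order_points p)"
  by (subst second_order_points_eq_affine_hull)
    (intro spectrahedron_Int spectrahedron_affine_hull spectrahedron_psd_H)

text \<open>The trace is \<open>(1/6) (y \<bullet> (H a *v y) + y \<bullet> (C y *v y))\<close> with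
  \<open>y = x - a\<close>. It absorbs the whole cubic term and leaves the quadratic one with
  coefficient 1/2 - 1/6 = 1/3.\<close>

lemma sdp_feasible_second_order_point:
  assumes a: "a \<in> second_order_points p"
  shows "sdp_feasible p (p a) (\<lambda>x. (1/3) * ((x - a) \<bullet> (H a *v (x - a))))
    (\<lambda>x. \<chi> i j. (1/6) * ((x - a) $ i * (x - a) $ j))"
proof -
  let ?S = "\<lambda>x. \<chi> i j. (1/6) * ((x - a) $ i * (x - a) $ j)"
  \<comment> \<open>A single row suffices, so the index \<open>k\<close> is ignored.\<close>
  let ?R = "\<lambda>(k::nat) i x. sqrt (1/6) * (x - a) $ i"
  have SO: "grad a = 0" "psd (H a)"
    using a by (auto simp: second_order_points_iff)
  obtain r v where v: "\<And>x. x \<bullet> (H a *v x) = (\<Sum>k<(r::nat). (v k \<bullet> x)\<^sup>2)"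
    using psd_operator_sum_squares[OF psd_operator_matrix[OF SO(2)]] by blast
  have S_eq: "?S x $ i $ j = (\<Sum>k<1. ?R k i x * ?R k j x)" for x i j
  proof -
    have "?S x $ i $ j = (sqrt (1/6))\<^sup>2 * ((x - a) $ i * (x - a) $ j)" by simp
    also have "\<dots> = ?R 0 i x * ?R 0 j x" by (simp only: power2_eq_square mult_ac)
    also have "\<dots> = (\<Sum>k<1. ?R k i x * ?R k j x)"
      by (simp only: One_nat_def sum.lessThan_Suc lessThan_0 sum.empty add_0)
    finally show ?thesis .
  qed
  have component: "poly_deg_le 1 (\<lambda>x. (x - a) $ i)" for i
    using poly_deg_le_inner[of "axis i 1" a] by (simp add: inner_axis' inner_diff_right)
  have "p x - p a = (1/3) * ((x - a) \<bullet> (H a *v (x - a))) + trace (?S x ** hessian p x)" for x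
  proof -
    define y where "y = x - a"
    have R: "(\<chi> i. ?R k i x) = sqrt (1/6) *\<^sub>R y" for k
      by (simp add: y_def vec_eq_iff)
    have "trace (?S x ** H x) = (\<Sum>k<(1::nat). (\<chi> i. ?R k i x) \<bullet> (H x *v (\<chi> i. ?R k i x)))"
      by (rule trace_sos_matrix_mult[OF S_eq H_sym])
    also have "\<dots> = (sqrt (1/6))\<^sup>2 * (y \<bullet> (H x *v y))"
      unfolding R
      by (simp only: One_nat_def sum.lessThan_Suc lessThan_0 sum.empty add_0
          matrix_vector_mult_scaleR inner_scaleR_left inner_scaleR_right power2_eq_square mult.assoc)
    finally have "trace (?S x ** H x) = (1/6) * (y \<bullet> (H x *v y))" by simp
    then show ?thesis
      using p_shift[of a y] inner_H_shift[of y a] SO(1) unfolding hessian_p y_def by simp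
  qed
  \<comment> \<open>In this form both the degree bound and the sos property of \<sigma> can be read
    off.\<close>
  moreover have sos_eq: "(1/3) * ((x - a) \<bullet> (H a *v (x - a)))
      = (\<Sum>k<r. (sqrt (1/3) * (v k \<bullet> (x - a)))\<^sup>2)" for x
    unfolding v by (simp add: power_mult_distrib sum_distrib_left real_sqrt_divide power_divide)
  moreover have "poly_deg_le 2 (\<lambda>x. \<Sum>k<r. (sqrt (1/3) * (v k \<bullet> (x - a)))\<^sup>2)"
    by (intro poly_deg_le_sum poly_deg_le_square poly_deg_le_cmult poly_deg_le_inner)
  moreover have "sos (\<lambda>x. \<Sum>k<r. (sqrt (1/3) * (v k \<bullet> (x - a)))\<^sup>2)"
    unfolding sos_def
    by (intro exI[of _ r] exI[of _ "\<lambda>k x. sqrt (1/3) * (v k \<bullet> (x - a))"] conjI allI impI refl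
        poly_deg_le_imp_polynomial[of 1] poly_deg_le_cmult poly_deg_le_inner)
  moreover have "sos_matrix ?S"
    unfolding sos_matrix_def
    by (intro exI[of _ 1] exI[of _ ?R] conjI allI impI S_eq
        poly_deg_le_imp_polynomial[of 1] poly_deg_le_cmult component)
  moreover have "poly_deg_le 2 (\<lambda>x. ?S x $ i $ j)" for i j
    using poly_deg_le_cmult[OF poly_deg_le_mult[OF component component], of "1/6" i j]
    by (simp add: numeral_2_eq_2)
  ultimately show ?thesis
    unfolding sdp_feasible_def by simp
qed

end

section \<open>Every cubic has a symmetric expansion\<close>

lemma sum_permutations_3:
  fixes F :: "'n \<Rightarrow> 'n \<Rightarrow> 'n \<Rightarrow> real"
  shows "(\<Sum>i\<in>A. \<Sum>j\<in>A. \<Sum>k\<in>A. F i j k + F i k j + F j i k + F j k i + F k i j + F k j i)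
    = 6 * (\<Sum>i\<in>A. \<Sum>j\<in>A. \<Sum>k\<in>A. F i j k)"
proof -
  \<comment> \<open>The transpositions in \<open>1\<close> and \<open>2\<close> generate all
    permutations of the three indices.\<close>
  have 1: "(\<Sum>i\<in>A. \<Sum>j\<in>A. \<Sum>k\<in>A. F i k j) = (\<Sum>i\<in>A. \<Sum>j\<in>A. \<Sum>k\<in>A. F i j k)" for F :: "'n \<Rightarrow> 'n \<Rightarrow> 'n \<Rightarrow> real"
    by (intro sum.cong refl sum.swap)
  have 2: "(\<Sum>i\<in>A. \<Sum>j\<in>A. \<Sum>k\<in>A. F j i k) = (\<Sum>i\<in>A. \<Sum>j\<in>A. \<Sum>k\<in>A. F i j k)" for F :: "'n \<Rightarrow> 'n \<Rightarrow> 'n \<Rightarrow> real"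
    by (rule sum.swap)
  show ?thesis
    using 1[of F] 2[of F] 1[of "\<lambda>i j k. F j i k"] 2[of "\<lambda>i j k. F i k j"]
      1[of "\<lambda>i j k. F j k i"]
    by (simp add: sum.distrib)
qed

lemma cubic_expansion_exists:
  fixes p :: "real ^ 'n \<Rightarrow> real"
  assumes "poly_deg_le 3 p"
  shows "\<exists>c g h C. cubic_expansion p c g h C"
proof -
  obtain c a b d where p: "\<And>x. p x = c + (\<Sum>i\<in>UNIV. x $ i * (a i + (\<Sum>j\<in>UNIV. x $ j *
      (b i j + (\<Sum>k\<in>UNIV. x $ k * d i j k)))))"
    using poly_deg_le_3_nested[OF assms] by blast
  \<comment> \<open>Symmetrizing over all six permutations multiplies the cubic form by 6, and
    \<open>b + b^T\<close> in \<open>h\<close> doubles the quadratic form; the factors 1/6 and 1/2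
    of the expansion cancel this.\<close>
  define t where "t i j k = d i j k + d i k j + d j i k + d j k i + d k i j + d k j i" for i j k
  define g :: "real ^ 'n" where "g = (\<chi> i. a i)"
  define h :: "real ^ 'n ^ 'n" where "h = (\<chi> i j. b i j + b j i)"
  define C :: "real ^ 'n \<Rightarrow> real ^ 'n ^ 'n" where "C x = (\<chi> i j. \<Sum>k\<in>UNIV. t i j k * x $ k)" for x
  have "cubic_expansion p c g h C"
  proof
    fix x y :: "real ^ 'n" and r :: real
    have "x \<bullet> (h *v x) = (\<Sum>i\<in>UNIV. \<Sum>j\<in>UNIV. x $ i * x $ j * b i j) +
        (\<Sum>i\<in>UNIV. \<Sum>j\<in>UNIV. x $ j * x $ i * b j i)"
      by (simp add: inner_matrix_sum h_def sum.distrib[symmetric] algebra_simps)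
    also have "(\<Sum>i\<in>UNIV. \<Sum>j\<in>UNIV. x $ j * x $ i * b j i) = (\<Sum>i\<in>UNIV. \<Sum>j\<in>UNIV. x $ i * x $ j * b i j)"
      by (rule sum.swap)
    finally have h: "x \<bullet> (h *v x) = 2 * (\<Sum>i\<in>UNIV. \<Sum>j\<in>UNIV. x $ i * x $ j * b i j)" by simp
    have "x \<bullet> (C x *v x) = (\<Sum>i\<in>UNIV. \<Sum>j\<in>UNIV. \<Sum>k\<in>UNIV. x $ i * x $ j * x $ k * t i j k)"
      by (simp add: inner_matrix_sum C_def sum_distrib_left sum_distrib_right mult_ac)
    also have "\<dots> = 6 * (\<Sum>i\<in>UNIV. \<Sum>j\<in>UNIV. \<Sum>k\<in>UNIV. x $ i * x $ j * x $ k * d i j k)"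
      unfolding sum_permutations_3[symmetric] t_def by (intro sum.cong refl) (simp add: algebra_simps)
    finally have C: "x \<bullet> (C x *v x)
      = 6 * (\<Sum>i\<in>UNIV. \<Sum>j\<in>UNIV. \<Sum>k\<in>UNIV. x $ i * x $ j * x $ k * d i j k)" .
    have "g \<bullet> x = (\<Sum>i\<in>UNIV. x $ i * a i)"
      by (simp add: inner_vec_def g_def mult.commute)
    then show "p x = c + g \<bullet> x + (1/2) * (x \<bullet> (h *v x)) + (1/6) * (x \<bullet> (C x *v x))"
      unfolding p h C by (simp add: distrib_left sum.distrib sum_distrib_left mult.assoc)
    show "transpose h = h"
      by (simp add: h_def transpose_def vec_eq_iff add.commute)
    show "C (x + y) = C x + C y" "C (r *\<^sub>R x) = r *\<^sub>R C x"
      by (simp_all add: C_def vec_eq_iff distrib_left sum.distrib sum_distrib_left mult_ac)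
    show "transpose (C x) = C x"
      by (simp add: C_def t_def transpose_def vec_eq_iff add_ac)
    show "C x *v y = C y *v x"
    proof (subst vec_eq_iff, rule allI)
      fix i
      have "(C x *v y) $ i = (\<Sum>j\<in>UNIV. \<Sum>k\<in>UNIV. t i j k * x $ k * y $ j)"
        by (simp add: C_def matrix_vector_mult_def sum_distrib_right)
      also have "\<dots> = (\<Sum>k\<in>UNIV. \<Sum>j\<in>UNIV. t i j k * x $ k * y $ j)"
        by (rule sum.swap)
      \<comment> \<open>The coefficients \<open>t\<close> are symmetric in their last two
        indices.\<close>
      also have "\<dots> = (\<Sum>k\<in>UNIV. \<Sum>j\<in>UNIV. t i k j * y $ j * x $ k)"
        by (intro sum.cong refl) (simp add: t_def algebra_simps)
      also have "\<dots> = (C y *v x) $ i"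
        by (simp add: C_def matrix_vector_mult_def sum_distrib_right)
      finally show "(C x *v y) $ i = (C y *v x) $ i" .
    qed
  qed
  then show ?thesis by blast
qed

section \<open>The semidefinite program\<close>

lemma sos_nonneg: "0 \<le> f x" if "sos f"
  using that by (auto simp: sos_def intro!: sum_nonneg)

lemma sos_matrix_trace_nonneg:
  fixes S :: "real ^ 'n \<Rightarrow> real ^ 'm ^ 'm"
  assumes "sos_matrix S" "psd M"
  shows "0 \<le> trace (S x ** M)"
proof -
  obtain r :: nat and R where S: "\<And>x i j. S x $ i $ j = (\<Sum>k<r. R k i x * R k j x)"
    using assms(1) unfolding sos_matrix_def by blast
  have "transpose M = M" "\<And>v. 0 \<le> v \<bullet> (M *v v)" using assms(2) by (auto simp: psd_iff)
  then show ?thesis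
    using trace_sos_matrix_mult[of "S x" "\<lambda>k i. R k i x" r M, OF S] by (simp add: sum_nonneg)
qed

theorem theorem6p3:
  fixes p \<sigma> :: "real ^ 'n \<Rightarrow> real" and \<gamma> :: real and S :: "real ^ 'n \<Rightarrow> real ^ 'n ^ 'n"
    and \<Gamma> :: "(real ^ 'n) set"
  assumes cubic: "poly_deg_le 3 p"
    and second_order_point: "second_order_points p \<noteq> {}"
    and optimal: "sdp_optimal p \<gamma> \<sigma> S"
    and Gamma: "\<Gamma> = {x. psd (hessian p x) \<and> \<sigma> x = 0 \<and> trace (S x ** hessian p x) = 0}"
  shows "spectrahedron \<Gamma> \<and> \<Gamma> = second_order_points p"
proof -
  obtain c g h C where "cubic_expansion p c g h C"
    using cubic_expansion_exists[OF cubic] by blast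
  then interpret cubic_expansion p c g h C .
  obtain a where a: "a \<in> second_order_points p"
    using second_order_point by blast
  have identity: "p x - \<gamma> = \<sigma> x + trace (S x ** hessian p x)" for x
    using optimal by (simp add: sdp_optimal_def sdp_feasible_def)
  have \<sigma>: "0 \<le> \<sigma> x" for x
    using optimal by (intro sos_nonneg) (simp add: sdp_optimal_def sdp_feasible_def)
  have S: "0 \<le> trace (S x ** hessian p x)" if "psd (hessian p x)" for x
    using optimal that by (intro sos_matrix_trace_nonneg) (simp_all add: sdp_optimal_def sdp_feasible_def)
  \<comment> \<open>Feasibility of the value \<open>p a\<close> gives this bound; the reverse one is
    the identity at \<open>a\<close>, where both terms on the right are nonnegative.\<close>
  have "p a \<le> \<gamma>"
    using optimal sdp_feasible_second_order_point[OF a] unfolding sdp_optimal_def by blast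
  moreover have "psd (hessian p a)"
    using a by (simp add: second_order_points_def)
  ultimately have \<gamma>: "\<gamma> = p a"
    using identity[of a] \<sigma>[of a] S[of a] by linarith
  have "\<Gamma> = {x. psd (hessian p x) \<and> p x = \<gamma>}"
  proof (unfold Gamma, intro Collect_cong conj_cong refl)
    \<comment> \<open>Two nonnegative numbers with sum \<open>p x - \<gamma>\<close> both vanish
      exactly when the sum does.\<close>
    fix x assume "psd (hessian p x)"
    then show "\<sigma> x = 0 \<and> trace (S x ** hessian p x) = 0 \<longleftrightarrow> p x = \<gamma>"
      using identity[of x] \<sigma>[of x] S[of x] by linarith
  qed
  then have "\<Gamma> = second_order_points p"
    using second_order_points_eq_level[OF a] by (simp add: \<gamma> hessian_p)
  then show ?thesis
    using spectrahedron_second_order_points by simp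
qed

end
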